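(* Let $M$ be a differentiable manifold and $k\geq 1$ an integer. Every symmetric homomorphism of $C^\infty(M)$-modules $P:\mathcal{X}\to\mathfrak{D}^k_0(M)$ is the principal homomorphism of a unique torsion free compatible $\mathfrak{D}^k_0(M)$-pseudoconnection of $TM$.
   Context: Manifolds are $C^\infty$. $\mathcal{X}$ is the $C^\infty(M)$-module of $C^\infty$ vector fields on $M$. $\mathfrak{D}^k(M)$ is the $C^\infty(M)$-module of all maps $d:\mathcal{X}\times\cdots\times\mathcal{X}\to C^\infty(M)$ ($k$ factors), with pointwise sum and multiplication by functions; $\mathfrak{D}^k_0(M)$ is the submodule of those $d$ that are $C^\infty(M)$-linear in the first variable. For a $C^\infty(M)$-module $\mathfrak{D}$, a $\mathfrak{D}$-pseudoconnection of $TM$ is an $\mathbb{R}$-bilinear map $\nabla:\mathcal{X}\times\mathcal{X}\to\mathfrak{D}$, written $\nabla_XY$, for which there is a $C^\infty(M)$-module homomorphism $P:\mathcal{X}\to\mathfrak{D}$ (the principal homomorphism of $\nabla$) with $\nabla_{\varphi X}Y=\varphi\nabla_XY$ and $\nabla_X(\varphi Y)=X(\varphi)P(Y)+\varphi\nabla_XY$ for all $X,Y\in\mathcal{X}$, $\varphi\in C^\infty(M)$. It is torsion free if $\nabla_XY-\nabla_YX=P([X,Y])$ for all $X,Y\in\mathcal{X}$. A $\mathfrak{D}^k_0(M)$-pseudoconnection $\nabla$ of $TM$ with principal homomorphism $P$ is compatible if $X\big(P(Y)(X_1,\dots,X_k)\big)=\nabla_XY(X_1,\dots,X_k)+\nabla_XX_1(Y,X_2,\dots,X_k)$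 for all $X,Y,X_1,\dots,X_k\in\mathcal{X}$. A homomorphism $P:\mathcal{X}\to\mathfrak{D}^k(M)$ is symmetric if $P(X)(X_1,\dots,X_k)=P(X_1)(X,X_2,\dots,X_k)$ for all $X,X_1,\dots,X_k\in\mathcal{X}$. *)

theory Defs
  imports "HOL-Analysis.Analysis" "HOL-Algebra.Module"
begin

section \<open>Smooth functions on open subsets of Euclidean space\<close>

text \<open>
  A point of $n$-dimensional space is a point of \<^term>\<open>Euclidean_space n\<close>, i.e. a function
  \<^typ>\<open>nat \<Rightarrow> real\<close> vanishing at all indices \<open>\<ge> n\<close>. This covers \<open>n = 0\<close> as well.
\<close>

definition partial_deriv :: "nat \<Rightarrow> ((nat \<Rightarrow> real) \<Rightarrow> real) \<Rightarrow> (nat \<Rightarrow> real) \<Rightarrow> real" where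
  "partial_deriv i f x = deriv (\<lambda>t. f (x(i := t))) (x i)"

text \<open>\<open>V\<close> is meant to be open in \<^term>\<open>Euclidean_space n\<close>.\<close>

primrec Ck_on :: "nat \<Rightarrow> nat \<Rightarrow> (nat \<Rightarrow> real) set \<Rightarrow> ((nat \<Rightarrow> real) \<Rightarrow> real) \<Rightarrow> bool" where
  "Ck_on n 0 V f \<longleftrightarrow> continuous_map (subtopology (Euclidean_space n) V) euclideanreal f"
| "Ck_on n (Suc r) V f \<longleftrightarrow>
     continuous_map (subtopology (Euclidean_space n) V) euclideanreal f \<and>
     (\<forall>i<n. (\<forall>x\<in>V. (\<lambda>t. f (x(i := t))) differentiable at (x i)) \<and>
            Ck_on n r V (partial_deriv i f))"

definition Cinf_on :: "nat \<Rightarrow> (nat \<Rightarrow> real) set \<Rightarrow> ((nat \<Rightarrow> real) \<Rightarrow> real) \<Rightarrow> bool" where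
  "Cinf_on n V f \<longleftrightarrow> (\<forall>r. Ck_on n r V f)"

section \<open>Smooth manifolds\<close>

text \<open>
  The smooth structure is given by an atlas, which need not be maximal: the smooth
  functions for an atlas and for the maximal atlas containing it are the same.
\<close>

record 'a manifold =
  mdim :: nat
  mtop :: "'a topology"
  charts :: "('a set \<times> ('a \<Rightarrow> nat \<Rightarrow> real)) set"

abbreviation points :: "'a manifold \<Rightarrow> 'a set" where
  "points M \<equiv> topspace (mtop M)"

definition smooth_manifold :: "'a manifold \<Rightarrow> bool" where
  "smooth_manifold M \<longleftrightarrow>
     Hausdorff_space (mtop M) \<and> second_countable (mtop M) \<and>
     (\<Union>(U, \<phi>)\<in>charts M. U) = points M \<and>
     (\<forall>(U, \<phi>)\<in>charts M.
        openin (mtop M) U \<and> openin (Euclidean_space (mdim M)) (\<phi> ` U) \<and>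
        homeomorphic_map (subtopology (mtop M) U)
          (subtopology (Euclidean_space (mdim M)) (\<phi> ` U)) \<phi>) \<and>
     (\<forall>(U, \<phi>)\<in>charts M. \<forall>(W, \<psi>)\<in>charts M. \<forall>j<mdim M.
        Cinf_on (mdim M) (\<phi> ` (U \<inter> W)) (\<lambda>x. \<psi> (inv_into U \<phi> x) j))"

text \<open>
  Functions whose domain is a proper subset of a type (functions on \<open>M\<close>, tangent vectors,
  vector fields, pseudoconnections) are represented by their extensional
  (\<^const>\<open>undefined\<close> outside the domain) representatives, so that HOL equality is equality of
  functions.
\<close>

definition C_inf :: "'a manifold \<Rightarrow> ('a \<Rightarrow> real) ring" where
  "C_inf M =
     \<lparr>carrier = {f \<in> extensional (points M).
        \<forall>(U, \<phi>)\<in>charts M. Cinf_on (mdim M) (\<phi> ` U) (\<lambda>x. f (inv_into U \<phi> x))},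
      mult = (\<lambda>f g. \<lambda>p\<in>points M. f p * g p),
      one = (\<lambda>p\<in>points M. 1),
      zero = (\<lambda>p\<in>points M. 0),
      add = (\<lambda>f g. \<lambda>p\<in>points M. f p + g p)\<rparr>"

definition const_fun :: "'a manifold \<Rightarrow> real \<Rightarrow> 'a \<Rightarrow> real" where
  "const_fun M c = (\<lambda>p\<in>points M. c)"

section \<open>Vector fields\<close>

text \<open>
  A tangent vector at \<open>p\<close> is a derivation at \<open>p\<close> of the algebra of smooth functions.
\<close>

definition tangent_space :: "'a manifold \<Rightarrow> 'a \<Rightarrow> (('a \<Rightarrow> real) \<Rightarrow> real) set" where
  "tangent_space M p =
     {v \<in> extensional (carrier (C_inf M)).
        (\<forall>f\<in>carrier (C_inf M). \<forall>g\<in>carrier (C_inf M).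
           v (f \<oplus>\<^bsub>C_inf M\<^esub> g) = v f + v g \<and>
           v (f \<otimes>\<^bsub>C_inf M\<^esub> g) = v f * g p + f p * v g) \<and>
        (\<forall>c. \<forall>f\<in>carrier (C_inf M). v (const_fun M c \<otimes>\<^bsub>C_inf M\<^esub> f) = c * v f)}"

type_synonym 'a vfield = "'a \<Rightarrow> ('a \<Rightarrow> real) \<Rightarrow> real"

definition apply_field :: "'a manifold \<Rightarrow> 'a vfield \<Rightarrow> ('a \<Rightarrow> real) \<Rightarrow> 'a \<Rightarrow> real" where
  "apply_field M X f = (\<lambda>p\<in>points M. X p f)"

text \<open>
  A vector field assigns to each point a tangent vector; it is smooth iff it maps smooth
  functions to smooth functions. The fields \<open>mult\<close> and \<open>one\<close> of the record are not part of the
  module structure.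
\<close>

definition vector_fields :: "'a manifold \<Rightarrow> ('a \<Rightarrow> real, 'a vfield) module" where
  "vector_fields M =
     \<lparr>carrier = {X \<in> \<Pi>\<^sub>E p\<in>points M. tangent_space M p.
        \<forall>f\<in>carrier (C_inf M). apply_field M X f \<in> carrier (C_inf M)},
      mult = undefined, one = undefined,
      zero = (\<lambda>p\<in>points M. \<lambda>f\<in>carrier (C_inf M). 0),
      add = (\<lambda>X Y. \<lambda>p\<in>points M. \<lambda>f\<in>carrier (C_inf M). X p f + Y p f),
      smult = (\<lambda>\<phi> X. \<lambda>p\<in>points M. \<lambda>f\<in>carrier (C_inf M). \<phi> p * X p f)\<rparr>"

definition lie_bracket :: "'a manifold \<Rightarrow> 'a vfield \<Rightarrow> 'a vfield \<Rightarrow> 'a vfield" where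
  "lie_bracket M X Y = (\<lambda>p\<in>points M. \<lambda>f\<in>carrier (C_inf M).
     X p (apply_field M Y f) - Y p (apply_field M X f))"

section \<open>The modules of maps on $k$-tuples of vector fields\<close>

definition field_tuples :: "'a manifold \<Rightarrow> nat \<Rightarrow> 'a vfield list set" where
  "field_tuples M k = {Xs. length Xs = k \<and> set Xs \<subseteq> carrier (vector_fields M)}"

definition Dk :: "'a manifold \<Rightarrow> nat \<Rightarrow> ('a \<Rightarrow> real, 'a vfield list \<Rightarrow> 'a \<Rightarrow> real) module" where
  "Dk M k =
     \<lparr>carrier = field_tuples M k \<rightarrow>\<^sub>E carrier (C_inf M),
      mult = undefined, one = undefined,
      zero = (\<lambda>Xs\<in>field_tuples M k. \<zero>\<^bsub>C_inf M\<^esub>),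
      add = (\<lambda>d e. \<lambda>Xs\<in>field_tuples M k. d Xs \<oplus>\<^bsub>C_inf M\<^esub> e Xs),
      smult = (\<lambda>\<phi> d. \<lambda>Xs\<in>field_tuples M k. \<phi> \<otimes>\<^bsub>C_inf M\<^esub> d Xs)\<rparr>"

definition Dk0 :: "'a manifold \<Rightarrow> nat \<Rightarrow> ('a \<Rightarrow> real, 'a vfield list \<Rightarrow> 'a \<Rightarrow> real) module" where
  "Dk0 M k = (Dk M k)
     \<lparr>carrier := {d \<in> carrier (Dk M k).
        \<forall>Xs\<in>field_tuples M (k - 1). \<forall>X\<in>carrier (vector_fields M).
          (\<forall>Y\<in>carrier (vector_fields M).
             d ((X \<oplus>\<^bsub>vector_fields M\<^esub> Y) # Xs) = d (X # Xs) \<oplus>\<^bsub>C_inf M\<^esub> d (Y # Xs)) \<and>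
          (\<forall>\<phi>\<in>carrier (C_inf M).
             d ((\<phi> \<odot>\<^bsub>vector_fields M\<^esub> X) # Xs) = \<phi> \<otimes>\<^bsub>C_inf M\<^esub> d (X # Xs))}\<rparr>"

section \<open>Pseudoconnections\<close>

definition module_homs ::
  "'r ring \<Rightarrow> ('r, 'a) module \<Rightarrow> ('r, 'b) module \<Rightarrow> ('a \<Rightarrow> 'b) set" where
  "module_homs R E F =
     {h \<in> carrier E \<rightarrow> carrier F.
        (\<forall>x\<in>carrier E. \<forall>y\<in>carrier E. h (x \<oplus>\<^bsub>E\<^esub> y) = h x \<oplus>\<^bsub>F\<^esub> h y) \<and>
        (\<forall>a\<in>carrier R. \<forall>x\<in>carrier E. h (a \<odot>\<^bsub>E\<^esub> x) = a \<odot>\<^bsub>F\<^esub> h x)}"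

definition real_bilinear ::
  "'a manifold \<Rightarrow> ('a \<Rightarrow> real, 'd) module \<Rightarrow> ('a vfield \<Rightarrow> 'a vfield \<Rightarrow> 'd) \<Rightarrow> bool" where
  "real_bilinear M \<DD> nabla \<longleftrightarrow>
     (\<forall>X\<in>carrier (vector_fields M). \<forall>Y\<in>carrier (vector_fields M).
        (\<forall>Z\<in>carrier (vector_fields M).
           nabla (X \<oplus>\<^bsub>vector_fields M\<^esub> Y) Z = nabla X Z \<oplus>\<^bsub>\<DD>\<^esub> nabla Y Z \<and>
           nabla Z (X \<oplus>\<^bsub>vector_fields M\<^esub> Y) = nabla Z X \<oplus>\<^bsub>\<DD>\<^esub> nabla Z Y) \<and>
        (\<forall>c. nabla (const_fun M c \<odot>\<^bsub>vector_fields M\<^esub> X) Y = const_fun M c \<odot>\<^bsub>\<DD>\<^esub> nabla X Y \<and>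
             nabla X (const_fun M c \<odot>\<^bsub>vector_fields M\<^esub> Y) = const_fun M c \<odot>\<^bsub>\<DD>\<^esub> nabla X Y))"

definition principal_hom ::
  "'a manifold \<Rightarrow> ('a \<Rightarrow> real, 'd) module \<Rightarrow> ('a vfield \<Rightarrow> 'a vfield \<Rightarrow> 'd) \<Rightarrow>
   ('a vfield \<Rightarrow> 'd) \<Rightarrow> bool" where
  "principal_hom M \<DD> nabla P \<longleftrightarrow>
     P \<in> module_homs (C_inf M) (vector_fields M) \<DD> \<and>
     (\<forall>X\<in>carrier (vector_fields M). \<forall>Y\<in>carrier (vector_fields M). \<forall>\<phi>\<in>carrier (C_inf M).
        nabla (\<phi> \<odot>\<^bsub>vector_fields M\<^esub> X) Y = \<phi> \<odot>\<^bsub>\<DD>\<^esub> nabla X Y \<and>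
        nabla X (\<phi> \<odot>\<^bsub>vector_fields M\<^esub> Y) =
          (apply_field M X \<phi> \<odot>\<^bsub>\<DD>\<^esub> P Y) \<oplus>\<^bsub>\<DD>\<^esub> (\<phi> \<odot>\<^bsub>\<DD>\<^esub> nabla X Y))"

definition pseudoconnection ::
  "'a manifold \<Rightarrow> ('a \<Rightarrow> real, 'd) module \<Rightarrow> ('a vfield \<Rightarrow> 'a vfield \<Rightarrow> 'd) \<Rightarrow> bool" where
  "pseudoconnection M \<DD> nabla \<longleftrightarrow>
     nabla \<in> carrier (vector_fields M) \<rightarrow>\<^sub>E (carrier (vector_fields M) \<rightarrow>\<^sub>E carrier \<DD>) \<and>
     real_bilinear M \<DD> nabla \<and> (\<exists>P. principal_hom M \<DD> nabla P)"

text \<open>In the next two definitions \<open>P\<close> is the principal homomorphism of \<open>nabla\<close>.\<close>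

definition torsion_free ::
  "'a manifold \<Rightarrow> ('a \<Rightarrow> real, 'd) module \<Rightarrow> ('a vfield \<Rightarrow> 'd) \<Rightarrow>
   ('a vfield \<Rightarrow> 'a vfield \<Rightarrow> 'd) \<Rightarrow> bool" where
  "torsion_free M \<DD> P nabla \<longleftrightarrow>
     (\<forall>X\<in>carrier (vector_fields M). \<forall>Y\<in>carrier (vector_fields M).
        nabla X Y \<ominus>\<^bsub>\<DD>\<^esub> nabla Y X = P (lie_bracket M X Y))"

definition compatible ::
  "'a manifold \<Rightarrow> nat \<Rightarrow> ('a vfield \<Rightarrow> 'a vfield list \<Rightarrow> 'a \<Rightarrow> real) \<Rightarrow>
   ('a vfield \<Rightarrow> 'a vfield \<Rightarrow> 'a vfield list \<Rightarrow> 'a \<Rightarrow> real) \<Rightarrow> bool" where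
  "compatible M k P nabla \<longleftrightarrow>
     (\<forall>X\<in>carrier (vector_fields M). \<forall>Y\<in>carrier (vector_fields M).
      \<forall>X1\<in>carrier (vector_fields M). \<forall>Xs\<in>field_tuples M (k - 1).
        apply_field M X (P Y (X1 # Xs)) =
          nabla X Y (X1 # Xs) \<oplus>\<^bsub>C_inf M\<^esub> nabla X X1 (Y # Xs))"

definition symmetric_hom ::
  "'a manifold \<Rightarrow> nat \<Rightarrow> ('a vfield \<Rightarrow> 'a vfield list \<Rightarrow> 'a \<Rightarrow> real) \<Rightarrow> bool" where
  "symmetric_hom M k P \<longleftrightarrow>
     (\<forall>X\<in>carrier (vector_fields M). \<forall>X1\<in>carrier (vector_fields M).
      \<forall>Xs\<in>field_tuples M (k - 1). P X (X1 # Xs) = P X1 (X # Xs))"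

end

theory Submission
  imports Defs
begin

text \<open>
  Fix the last \<open>k - 1\<close> arguments \<open>Zs\<close>. Then \<open>g Y Z = P Y (Z # Zs)\<close> is a symmetric
  \<open>C\<^sup>\<infinity>(M)\<close>-bilinear form, and torsion freeness and compatibility are the two axioms of the
  Levi-Civita connection for \<open>g\<close>, with \<open>n(X,Y,Z) = nabla X Y (Z # Zs)\<close> in the role of
  \<open>g(\<nabla>\<^sub>X Y, Z)\<close>. The pseudoconnection takes the form \<open>n(X,Y,\<cdot>)\<close> itself as its value, not a
  vector field representing this form, so nondegeneracy of \<open>g\<close> plays no role: the Koszul formula
  determines \<open>n\<close> and conversely can be used to define it.
\<close>

section \<open>Algebra of smooth functions\<close>

lemma eventually_fun_upd_in_open:
  assumes "openin (Euclidean_space n) V" "x \<in> V" "i < n"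
  shows "\<forall>\<^sub>F t in nhds (x i). x(i := t) \<in> V"
proof -
  have x: "x j = 0" if "j \<ge> n" for j
    using openin_subset[OF assms(1)] assms(2) that by (auto simp: topspace_Euclidean_space)
  \<comment> \<open>Changing only a coordinate i < n keeps all coordinates from n onwards zero, so
    the coordinate line through x stays in \<open>Euclidean_space n\<close> and is continuous into
    it.\<close>
  have "continuous_map euclideanreal (powertop_real UNIV) (\<lambda>t. x(i := t))"
    by (auto simp: continuous_map_componentwise_UNIV)
  then have "continuous_map euclideanreal (Euclidean_space n) (\<lambda>t. x(i := t))"
    using x assms(3) by (auto simp: Euclidean_space_def continuous_map_in_subtopology)
  then have "open {t. x(i := t) \<in> V}"
    using openin_continuous_map_preimage[OF _ assms(1)] by fastforce
  then show ?thesis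
    using assms(2) eventually_nhds_in_open by fastforce
qed

lemma partial_deriv_cong:
  assumes "openin (Euclidean_space n) V" "\<And>y. y \<in> V \<Longrightarrow> f y = g y" "x \<in> V" "i < n"
  shows "partial_deriv i f x = partial_deriv i g x"
  unfolding partial_deriv_def
  by (rule deriv_cong_ev)
    (use eventually_mono[OF eventually_fun_upd_in_open[OF assms(1,3,4)]] assms(2) in auto)

text \<open>Local representatives such as \<open>f (inv_into U \<phi> x)\<close> have arbitrary
  values outside \<open>V\<close>. Openness of \<open>V\<close> makes every partial derivative at a
  point of \<open>V\<close> depend only on values in \<open>V\<close>, and the induction passes to
  these derivatives, hence the generalisation over \<open>f\<close> and \<open>g\<close>.\<close>

lemma Ck_on_cong:
  assumes V: "openin (Euclidean_space n) V"
    and "\<And>x. x \<in> V \<Longrightarrow> f x = g x" "Ck_on n r V f"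
  shows "Ck_on n r V g"
  using assms(2,3)
proof (induction r arbitrary: f g)
  case 0
  then show ?case
    by (auto elim!: continuous_map_eq)
next
  case (Suc r)
  have "(\<lambda>t. g (x(i := t))) differentiable at (x i)" if "i < n" "x \<in> V" for i x
  proof -
    have "\<forall>\<^sub>F t in nhds (x i). f (x(i := t)) = g (x(i := t))"
      by (rule eventually_mono[OF eventually_fun_upd_in_open[OF V that(2,1)]]) (rule Suc.prems(1))
    moreover have "(\<lambda>t. f (x(i := t))) differentiable at (x i)"
      using Suc.prems that by auto
    ultimately show ?thesis
      unfolding real_differentiable_def by (simp add: DERIV_cong_ev[OF refl _ refl])
  qed
  moreover have "Ck_on n r V (partial_deriv i g)" if "i < n" for i
    by (rule Suc.IH[of "partial_deriv i f"])
      (use partial_deriv_cong[OF V Suc.prems(1) _ that] Suc.prems(2) that in simp_all)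
  moreover have "continuous_map (subtopology (Euclidean_space n) V) euclideanreal g"
    using Suc.prems by (auto elim!: continuous_map_eq)
  ultimately show ?case
    by auto
qed

lemma Ck_on_SucD: "Ck_on n (Suc r) V f \<Longrightarrow> Ck_on n r V f"
  by (induction r arbitrary: f) auto

lemma Ck_on_const: "Ck_on n r V (\<lambda>x. c)"
  by (induction r arbitrary: c) (auto simp: partial_deriv_def[abs_def])

lemma Ck_on_add:
  assumes V: "openin (Euclidean_space n) V"
    and "Ck_on n r V f" "Ck_on n r V g"
  shows "Ck_on n r V (\<lambda>x. f x + g x)"
  using assms(2,3)
proof (induction r arbitrary: f g)
  case 0
  then show ?case
    by (auto intro: continuous_map_add)
next
  case (Suc r)
  have "Ck_on n r V (partial_deriv i (\<lambda>x. f x + g x))" if "i < n" for i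
  \<comment> \<open>The sum rule is available only at points of \<open>V\<close>, so the derivative
    is replaced through the congruence rule instead of by an equation of functions.\<close>
  proof (rule Ck_on_cong[OF V])
    show "Ck_on n r V (\<lambda>x. partial_deriv i f x + partial_deriv i g x)"
      using Suc that by auto
    show "partial_deriv i f x + partial_deriv i g x = partial_deriv i (\<lambda>x. f x + g x) x"
      if "x \<in> V" for x
      unfolding partial_deriv_def
      by (rule deriv_add[symmetric])
        (use Suc.prems \<open>i < n\<close> that in
          \<open>auto simp: field_differentiable_def real_differentiable_def\<close>)
  qed
  then show ?case
    using Suc.prems by (auto intro: continuous_map_add)
qed

lemma Ck_on_mult:
  assumes V: "openin (Euclidean_space n) V"
    and "Ck_on n r V f" "Ck_on n r V g"
  shows "Ck_on n r V (\<lambda>x. f x * g x)"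
  using assms(2,3)
proof (induction r arbitrary: f g)
  case 0
  then show ?case
    by (auto intro: continuous_map_real_mult)
next
  case (Suc r)
  have "Ck_on n r V (partial_deriv i (\<lambda>x. f x * g x))" if "i < n" for i
  proof (rule Ck_on_cong[OF V])
    show "Ck_on n r V (\<lambda>x. f x * partial_deriv i g x + partial_deriv i f x * g x)"
      \<comment> \<open>In each summand of the product rule one factor is undifferentiated; its
        regularity is lowered from \<open>Suc r\<close> to \<open>r\<close> so that the induction
        hypothesis applies to both products.\<close>
      using Suc.prems[THEN Ck_on_SucD] Suc.prems that by (intro Ck_on_add[OF V] Suc.IH) simp_all
    show "f x * partial_deriv i g x + partial_deriv i f x * g x = partial_deriv i (\<lambda>x. f x * g x) x"
      if "x \<in> V" for x
      unfolding partial_deriv_def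
      by (subst deriv_mult)
        (use Suc.prems \<open>i < n\<close> that in
          \<open>auto simp: field_differentiable_def real_differentiable_def\<close>)
  qed
  then show ?case
    using Suc.prems by (auto intro: continuous_map_real_mult)
qed

section \<open>The ring of smooth functions on M\<close>

lemma C_inf_simps [simp]:
  "p \<in> points M \<Longrightarrow> (f \<oplus>\<^bsub>C_inf M\<^esub> g) p = f p + g p"
  "p \<in> points M \<Longrightarrow> (f \<otimes>\<^bsub>C_inf M\<^esub> g) p = f p * g p"
  "p \<in> points M \<Longrightarrow> \<zero>\<^bsub>C_inf M\<^esub> p = 0"
  "p \<in> points M \<Longrightarrow> const_fun M c p = c"
  "p \<in> points M \<Longrightarrow> apply_field M X f p = X p f"
  by (simp_all add: C_inf_def const_fun_def apply_field_def)

lemma C_inf_extensional [simp]: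
  "f \<oplus>\<^bsub>C_inf M\<^esub> g \<in> extensional (points M)"
  "f \<otimes>\<^bsub>C_inf M\<^esub> g \<in> extensional (points M)"
  "\<zero>\<^bsub>C_inf M\<^esub> \<in> extensional (points M)"
  "apply_field M X f \<in> extensional (points M)"
  by (simp_all add: C_inf_def apply_field_def)

locale manifold_setting =
  fixes M :: "'a manifold"
  assumes smooth: "smooth_manifold M"
begin

abbreviation C :: "('a \<Rightarrow> real) set" where "C \<equiv> carrier (C_inf M)"
abbreviation E :: "'a vfield set" where "E \<equiv> carrier (vector_fields M)"

lemma C_inf_eqI:
  assumes "f \<in> extensional (points M)" "g \<in> extensional (points M)"
    "\<And>p. p \<in> points M \<Longrightarrow> f p = g p"
  shows "f = g"
  using assms by (rule extensionalityI)

text \<open>\<open>F\<close> is a plain formula for \<open>f\<close>, without the restriction to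
  \<open>points M\<close>, to which the \<open>Ck_on\<close> rules apply directly. On a chart image
  the two agree, because \<open>inv_into U \<phi>\<close> takes its values in
  \<open>U\<close>.\<close>

lemma C_I:
  assumes "f \<in> extensional (points M)"
    and Ck: "\<And>U \<phi> r. (U, \<phi>) \<in> charts M \<Longrightarrow> openin (Euclidean_space (mdim M)) (\<phi> ` U) \<Longrightarrow>
      Ck_on (mdim M) r (\<phi> ` U) (\<lambda>x. F (inv_into U \<phi> x))"
    and eq: "\<And>p. p \<in> points M \<Longrightarrow> F p = f p"
  shows "f \<in> C"
proof -
  have "Ck_on (mdim M) r (\<phi> ` U) (\<lambda>x. f (inv_into U \<phi> x))" if U: "(U, \<phi>) \<in> charts M" for U \<phi> r
  proof -
    have op: "openin (Euclidean_space (mdim M)) (\<phi> ` U)" and "U \<subseteq> points M"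
      using smooth U unfolding smooth_manifold_def by (blast dest: openin_subset)+
    then have "F (inv_into U \<phi> x) = f (inv_into U \<phi> x)" if "x \<in> \<phi> ` U" for x
      using inv_into_into[OF that] eq by blast
    then show ?thesis
      using Ck[OF U op] by (rule Ck_on_cong[OF op])
  qed
  then show ?thesis
    using assms(1) by (auto simp: C_inf_def Cinf_on_def)
qed

lemma C_Ck_on: "f \<in> C \<Longrightarrow> (U, \<phi>) \<in> charts M \<Longrightarrow> Ck_on (mdim M) r (\<phi> ` U) (\<lambda>x. f (inv_into U \<phi> x))"
  by (auto simp: C_inf_def Cinf_on_def)

lemma const_fun_C [simp]: "const_fun M c \<in> C"
  by (rule C_I[where F = "\<lambda>p. c"]) (simp_all add: Ck_on_const const_fun_def)

lemma add_C [simp]: "f \<in> C \<Longrightarrow> g \<in> C \<Longrightarrow> f \<oplus>\<^bsub>C_inf M\<^esub> g \<in> C"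
  by (rule C_I[where F = "\<lambda>p. f p + g p"]) (simp_all add: Ck_on_add C_Ck_on)

lemma mult_C [simp]: "f \<in> C \<Longrightarrow> g \<in> C \<Longrightarrow> f \<otimes>\<^bsub>C_inf M\<^esub> g \<in> C"
  by (rule C_I[where F = "\<lambda>p. f p * g p"]) (simp_all add: Ck_on_mult C_Ck_on)

lemma zero_C [simp]: "\<zero>\<^bsub>C_inf M\<^esub> \<in> C"
  using const_fun_C[of 0] by (simp add: C_inf_def const_fun_def)

lemma C_extensional [simp]: "f \<in> C \<Longrightarrow> f \<in> extensional (points M)"
  by (simp add: C_inf_def)

text \<open>A real coefficient is multiplication by a constant function; this also yields closure
  under differences.\<close>

lemma lincomb_C:
  assumes "f \<in> C" "g \<in> C"
  shows "(\<lambda>p\<in>points M. a * f p + b * g p) \<in> C"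
proof -
  have "(\<lambda>p\<in>points M. a * f p + b * g p) =
      (const_fun M a \<otimes>\<^bsub>C_inf M\<^esub> f) \<oplus>\<^bsub>C_inf M\<^esub> (const_fun M b \<otimes>\<^bsub>C_inf M\<^esub> g)"
    by (rule C_inf_eqI) auto
  then show ?thesis
    using assms by simp
qed

section \<open>Vector fields\<close>

lemma E_tangent: "X \<in> E \<Longrightarrow> p \<in> points M \<Longrightarrow> X p \<in> tangent_space M p"
  by (auto simp: vector_fields_def)

lemma E_extensional: "X \<in> E \<Longrightarrow> X \<in> extensional (points M)"
  by (auto simp: vector_fields_def PiE_def)

text \<open>Given the Leibniz rule, real homogeneity of a derivation amounts to vanishing on
  constants, which is the condition checked here.\<close>

lemma E_I:
  assumes "X \<in> extensional (points M)"
    and "\<And>p. p \<in> points M \<Longrightarrow> X p \<in> extensional C"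
    and "\<And>p f g. p \<in> points M \<Longrightarrow> f \<in> C \<Longrightarrow> g \<in> C \<Longrightarrow> X p (f \<oplus>\<^bsub>C_inf M\<^esub> g) = X p f + X p g"
    and "\<And>p f g. p \<in> points M \<Longrightarrow> f \<in> C \<Longrightarrow> g \<in> C \<Longrightarrow>
      X p (f \<otimes>\<^bsub>C_inf M\<^esub> g) = X p f * g p + f p * X p g"
    and "\<And>p c. p \<in> points M \<Longrightarrow> X p (const_fun M c) = 0"
    and "\<And>f. f \<in> C \<Longrightarrow> apply_field M X f \<in> C"
  shows "X \<in> E"
  using assms by (auto simp: vector_fields_def tangent_space_def PiE_def)

lemma E_eqI:
  assumes "X \<in> E" "Y \<in> E" "\<And>p f. p \<in> points M \<Longrightarrow> f \<in> C \<Longrightarrow> X p f = Y p f"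
  shows "X = Y"
proof (rule extensionalityI)
  show "X \<in> extensional (points M)" "Y \<in> extensional (points M)"
    using assms E_extensional by auto
  show "X p = Y p" if "p \<in> points M" for p
    by (rule extensionalityI[of _ C])
      (use E_tangent[OF assms(1) that] E_tangent[OF assms(2) that] assms(3)[OF that] in
        \<open>simp_all add: tangent_space_def\<close>)
qed

lemma vector_fields_extensional [simp]:
  "X \<oplus>\<^bsub>vector_fields M\<^esub> Y \<in> extensional (points M)"
  "\<phi> \<odot>\<^bsub>vector_fields M\<^esub> X \<in> extensional (points M)"
  "p \<in> points M \<Longrightarrow> (X \<oplus>\<^bsub>vector_fields M\<^esub> Y) p \<in> extensional C"
  "p \<in> points M \<Longrightarrow> (\<phi> \<odot>\<^bsub>vector_fields M\<^esub> X) p \<in> extensional C"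
  by (simp_all add: vector_fields_def)

lemma vector_fields_add [simp]:
  "p \<in> points M \<Longrightarrow> f \<in> C \<Longrightarrow> (X \<oplus>\<^bsub>vector_fields M\<^esub> Y) p f = X p f + Y p f"
  by (simp add: vector_fields_def)

lemma vector_fields_smult [simp]:
  "p \<in> points M \<Longrightarrow> f \<in> C \<Longrightarrow> (\<phi> \<odot>\<^bsub>vector_fields M\<^esub> X) p f = \<phi> p * X p f"
  by (simp add: vector_fields_def)

lemma apply_field_C [simp]: "X \<in> E \<Longrightarrow> f \<in> C \<Longrightarrow> apply_field M X f \<in> C"
  by (simp add: vector_fields_def)

lemma field_add [simp]:
  "X \<in> E \<Longrightarrow> p \<in> points M \<Longrightarrow> f \<in> C \<Longrightarrow> g \<in> C \<Longrightarrow> X p (f \<oplus>\<^bsub>C_inf M\<^esub> g) = X p f + X p g"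
  using E_tangent[of X p] by (auto simp: tangent_space_def)

lemma field_mult [simp]:
  "X \<in> E \<Longrightarrow> p \<in> points M \<Longrightarrow> f \<in> C \<Longrightarrow> g \<in> C \<Longrightarrow>
    X p (f \<otimes>\<^bsub>C_inf M\<^esub> g) = X p f * g p + f p * X p g"
  using E_tangent[of X p] by (auto simp: tangent_space_def)

lemma field_const_fun [simp]:
  assumes "X \<in> E" "p \<in> points M"
  shows "X p (const_fun M c) = 0"
proof -
  \<comment> \<open>Homogeneity evaluates the derivative of c * 1 as shown; the Leibniz rule adds
    the term \<open>X p (const_fun M c)\<close>, which must therefore be zero.\<close>
  have "X p (const_fun M c \<otimes>\<^bsub>C_inf M\<^esub> const_fun M 1) = c * X p (const_fun M 1)"
    using E_tangent[OF assms] const_fun_C unfolding tangent_space_def by blast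
  then show ?thesis
    using assms by simp
qed

lemma add_E [simp]:
  assumes "X \<in> E" "Y \<in> E"
  shows "X \<oplus>\<^bsub>vector_fields M\<^esub> Y \<in> E"
proof (rule E_I)
  show "apply_field M (X \<oplus>\<^bsub>vector_fields M\<^esub> Y) f \<in> C" if "f \<in> C" for f
  proof -
    have "apply_field M (X \<oplus>\<^bsub>vector_fields M\<^esub> Y) f = apply_field M X f \<oplus>\<^bsub>C_inf M\<^esub> apply_field M Y f"
      by (rule C_inf_eqI) (use that in auto)
    then show ?thesis
      using assms that by simp
  qed
qed (use assms in \<open>auto simp: algebra_simps\<close>)

lemma smult_E [simp]:
  assumes "\<phi> \<in> C" "X \<in> E"
  shows "\<phi> \<odot>\<^bsub>vector_fields M\<^esub> X \<in> E"
proof (rule E_I)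
  show "apply_field M (\<phi> \<odot>\<^bsub>vector_fields M\<^esub> X) f \<in> C" if "f \<in> C" for f
  proof -
    have "apply_field M (\<phi> \<odot>\<^bsub>vector_fields M\<^esub> X) f = \<phi> \<otimes>\<^bsub>C_inf M\<^esub> apply_field M X f"
      by (rule C_inf_eqI) (use that in auto)
    then show ?thesis
      using assms that by simp
  qed
qed (use assms in \<open>auto simp: algebra_simps\<close>)

lemma apply_field_add [simp]:
  "X \<in> E \<Longrightarrow> f \<in> C \<Longrightarrow> g \<in> C \<Longrightarrow>
    apply_field M X (f \<oplus>\<^bsub>C_inf M\<^esub> g) = apply_field M X f \<oplus>\<^bsub>C_inf M\<^esub> apply_field M X g"
  by (rule C_inf_eqI) auto

lemma apply_field_mult [simp]:
  "X \<in> E \<Longrightarrow> f \<in> C \<Longrightarrow> g \<in> C \<Longrightarrow> apply_field M X (f \<otimes>\<^bsub>C_inf M\<^esub> g) =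
    (apply_field M X f \<otimes>\<^bsub>C_inf M\<^esub> g) \<oplus>\<^bsub>C_inf M\<^esub> (f \<otimes>\<^bsub>C_inf M\<^esub> apply_field M X g)"
  by (rule C_inf_eqI) auto

lemma apply_field_const_fun [simp]:
  "X \<in> E \<Longrightarrow> apply_field M X (const_fun M c) = const_fun M 0"
  by (rule C_inf_eqI) auto

lemma apply_field_vector_fields_add [simp]:
  "f \<in> C \<Longrightarrow> apply_field M (X \<oplus>\<^bsub>vector_fields M\<^esub> Y) f =
    apply_field M X f \<oplus>\<^bsub>C_inf M\<^esub> apply_field M Y f"
  by (rule C_inf_eqI) auto

lemma apply_field_vector_fields_smult [simp]:
  "f \<in> C \<Longrightarrow> apply_field M (\<phi> \<odot>\<^bsub>vector_fields M\<^esub> X) f = \<phi> \<otimes>\<^bsub>C_inf M\<^esub> apply_field M X f"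
  by (rule C_inf_eqI) auto

section \<open>The Lie bracket of vector fields\<close>

lemma lie_bracket_apply [simp]:
  "p \<in> points M \<Longrightarrow> f \<in> C \<Longrightarrow>
    lie_bracket M X Y p f = X p (apply_field M Y f) - Y p (apply_field M X f)"
  by (simp add: lie_bracket_def)

lemma lie_bracket_extensional [simp]:
  "lie_bracket M X Y \<in> extensional (points M)"
  "p \<in> points M \<Longrightarrow> lie_bracket M X Y p \<in> extensional C"
  by (simp_all add: lie_bracket_def)

text \<open>Expanding X(Y(fg)) by the Leibniz rule produces the cross terms X(f)Y(g) + Y(f)X(g).
  They are symmetric in X and Y and cancel in the commutator, which is therefore again a
  derivation.\<close>

lemma lie_bracket_E [simp]:
  assumes "X \<in> E" "Y \<in> E"
  shows "lie_bracket M X Y \<in> E"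
proof (rule E_I)
  show "apply_field M (lie_bracket M X Y) f \<in> C" if "f \<in> C" for f
  proof -
    have "apply_field M (lie_bracket M X Y) f =
        (\<lambda>p\<in>points M. 1 * apply_field M X (apply_field M Y f) p
          + (-1) * apply_field M Y (apply_field M X f) p)"
      by (rule C_inf_eqI) (use that in auto)
    then show ?thesis
      using assms that by (simp only: lincomb_C apply_field_C)
  qed
qed (use assms in \<open>auto simp: algebra_simps\<close>)

lemma lie_bracket_add_left:
  "X \<in> E \<Longrightarrow> X' \<in> E \<Longrightarrow> Y \<in> E \<Longrightarrow> lie_bracket M (X \<oplus>\<^bsub>vector_fields M\<^esub> X') Y =
    lie_bracket M X Y \<oplus>\<^bsub>vector_fields M\<^esub> lie_bracket M X' Y"
  by (rule E_eqI) auto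

lemma lie_bracket_add_right:
  "X \<in> E \<Longrightarrow> X' \<in> E \<Longrightarrow> Y \<in> E \<Longrightarrow> lie_bracket M Y (X \<oplus>\<^bsub>vector_fields M\<^esub> X') =
    lie_bracket M Y X \<oplus>\<^bsub>vector_fields M\<^esub> lie_bracket M Y X'"
  by (rule E_eqI) auto

lemma lie_bracket_smult_right:
  "\<phi> \<in> C \<Longrightarrow> X \<in> E \<Longrightarrow> Y \<in> E \<Longrightarrow> lie_bracket M X (\<phi> \<odot>\<^bsub>vector_fields M\<^esub> Y) =
    (apply_field M X \<phi> \<odot>\<^bsub>vector_fields M\<^esub> Y) \<oplus>\<^bsub>vector_fields M\<^esub>
    (\<phi> \<odot>\<^bsub>vector_fields M\<^esub> lie_bracket M X Y)"
  by (rule E_eqI) (auto simp: algebra_simps)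

text \<open>The sign is written as multiplication by the constant function -1, so that linearity
  over smooth functions pulls it out of a form.\<close>

lemma lie_bracket_swap:
  "X \<in> E \<Longrightarrow> Y \<in> E \<Longrightarrow> lie_bracket M Y X = const_fun M (-1) \<odot>\<^bsub>vector_fields M\<^esub> lie_bracket M X Y"
  by (rule E_eqI) auto

lemma lie_bracket_smult_left:
  "\<phi> \<in> C \<Longrightarrow> X \<in> E \<Longrightarrow> Y \<in> E \<Longrightarrow> lie_bracket M (\<phi> \<odot>\<^bsub>vector_fields M\<^esub> X) Y =
    (const_fun M (-1) \<odot>\<^bsub>vector_fields M\<^esub> (apply_field M Y \<phi> \<odot>\<^bsub>vector_fields M\<^esub> X))
    \<oplus>\<^bsub>vector_fields M\<^esub> (\<phi> \<odot>\<^bsub>vector_fields M\<^esub> lie_bracket M X Y)"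
  by (rule E_eqI) (auto simp: algebra_simps)

end

section \<open>The Koszul formula\<close>

text \<open>The six-term Koszul expression with the factor 1/2 included; for a metric
  \<open>g\<close> with Levi-Civita connection \<nabla> it is the inner product of the covariant
  derivative of Y along X with Z.\<close>

definition koszul ::
  "'a manifold \<Rightarrow> ('a vfield \<Rightarrow> 'a vfield \<Rightarrow> 'a \<Rightarrow> real) \<Rightarrow>
   'a vfield \<Rightarrow> 'a vfield \<Rightarrow> 'a vfield \<Rightarrow> 'a \<Rightarrow> real" where
  "koszul M g X Y Z = (\<lambda>p\<in>points M.
     (X p (g Y Z) + Y p (g Z X) - Z p (g X Y) +
      g (lie_bracket M X Y) Z p - g (lie_bracket M Y Z) X p + g (lie_bracket M Z X) Y p) / 2)"

text \<open>Linearity is stated for the first argument only, and symmetry transfers it to the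
  second.\<close>

locale symmetric_bilinear_form = manifold_setting M for M :: "'a manifold" +
  fixes g :: "'a vfield \<Rightarrow> 'a vfield \<Rightarrow> 'a \<Rightarrow> real"
  assumes g_C [simp]: "X \<in> E \<Longrightarrow> Y \<in> E \<Longrightarrow> g X Y \<in> C"
    and g_sym: "X \<in> E \<Longrightarrow> Y \<in> E \<Longrightarrow> g X Y = g Y X"
    and g_add_left [simp]: "X \<in> E \<Longrightarrow> X' \<in> E \<Longrightarrow> Y \<in> E \<Longrightarrow>
      g (X \<oplus>\<^bsub>vector_fields M\<^esub> X') Y = g X Y \<oplus>\<^bsub>C_inf M\<^esub> g X' Y"
    and g_smult_left [simp]: "\<phi> \<in> C \<Longrightarrow> X \<in> E \<Longrightarrow> Y \<in> E \<Longrightarrow>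
      g (\<phi> \<odot>\<^bsub>vector_fields M\<^esub> X) Y = \<phi> \<otimes>\<^bsub>C_inf M\<^esub> g X Y"
begin

lemma g_add_right [simp]: "X \<in> E \<Longrightarrow> X' \<in> E \<Longrightarrow> Y \<in> E \<Longrightarrow>
    g Y (X \<oplus>\<^bsub>vector_fields M\<^esub> X') = g Y X \<oplus>\<^bsub>C_inf M\<^esub> g Y X'"
  by (simp add: g_sym[of Y])

lemma g_smult_right [simp]: "\<phi> \<in> C \<Longrightarrow> X \<in> E \<Longrightarrow> Y \<in> E \<Longrightarrow>
    g Y (\<phi> \<odot>\<^bsub>vector_fields M\<^esub> X) = \<phi> \<otimes>\<^bsub>C_inf M\<^esub> g Y X"
  by (simp add: g_sym[of Y])

lemma koszul_extensional [simp]: "koszul M g X Y Z \<in> extensional (points M)"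
  by (simp add: koszul_def)

lemma koszul_apply: "p \<in> points M \<Longrightarrow> koszul M g X Y Z p =
     (X p (g Y Z) + Y p (g Z X) - Z p (g X Y) +
      g (lie_bracket M X Y) Z p - g (lie_bracket M Y Z) X p + g (lie_bracket M Z X) Y p) / 2"
  by (simp add: koszul_def)

lemma koszul_C:
  assumes "X \<in> E" "Y \<in> E" "Z \<in> E"
  shows "koszul M g X Y Z \<in> C"
proof -
  \<comment> \<open>With negation expressed as a product, smoothness reduces to closure under sums
    and products.\<close>
  define minus where "minus f = const_fun M (-1) \<otimes>\<^bsub>C_inf M\<^esub> f" for f
  have "koszul M g X Y Z = const_fun M (1 / 2) \<otimes>\<^bsub>C_inf M\<^esub>
      (apply_field M X (g Y Z) \<oplus>\<^bsub>C_inf M\<^esub> apply_field M Y (g Z X) \<oplus>\<^bsub>C_inf M\<^esub>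
       minus (apply_field M Z (g X Y)) \<oplus>\<^bsub>C_inf M\<^esub> g (lie_bracket M X Y) Z \<oplus>\<^bsub>C_inf M\<^esub>
       minus (g (lie_bracket M Y Z) X) \<oplus>\<^bsub>C_inf M\<^esub> g (lie_bracket M Z X) Y)"
    by (rule C_inf_eqI) (auto simp: koszul_apply minus_def)
  then show ?thesis
    using assms by (simp add: minus_def)
qed

lemma koszul_add:
  assumes "X \<in> E" "X' \<in> E" "Y \<in> E" "Z \<in> E"
  shows "koszul M g (X \<oplus>\<^bsub>vector_fields M\<^esub> X') Y Z = koszul M g X Y Z \<oplus>\<^bsub>C_inf M\<^esub> koszul M g X' Y Z"
    and "koszul M g Y (X \<oplus>\<^bsub>vector_fields M\<^esub> X') Z = koszul M g Y X Z \<oplus>\<^bsub>C_inf M\<^esub> koszul M g Y X' Z"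
    and "koszul M g Y Z (X \<oplus>\<^bsub>vector_fields M\<^esub> X') = koszul M g Y Z X \<oplus>\<^bsub>C_inf M\<^esub> koszul M g Y Z X'"
  by - (rule C_inf_eqI;
      use assms in \<open>simp add: koszul_apply lie_bracket_add_left lie_bracket_add_right field_simps\<close>)+

text \<open>The derivatives of \<phi> cancel in pairs: Y(\<phi>) g(Z,X) against the contribution of
  [\<phi> X, Y], and -Z(\<phi>) g(X,Y) against that of [Z, \<phi> X].\<close>

lemma koszul_smult_left:
  assumes "\<phi> \<in> C" "X \<in> E" "Y \<in> E" "Z \<in> E"
  shows "koszul M g (\<phi> \<odot>\<^bsub>vector_fields M\<^esub> X) Y Z = \<phi> \<otimes>\<^bsub>C_inf M\<^esub> koszul M g X Y Z"
  by (rule C_inf_eqI)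
    (use assms in \<open>auto simp: koszul_apply lie_bracket_smult_left lie_bracket_smult_right
      g_sym[of Z X] g_sym[of Z Y] g_sym[of Y X] field_simps\<close>)

text \<open>Here X(\<phi>) g(Y,Z) cancels against the contribution of [\<phi> Z, X], and Y(\<phi>)
  g(Z,X) against that of [Y, \<phi> Z].\<close>

lemma koszul_smult_right:
  assumes "\<phi> \<in> C" "X \<in> E" "Y \<in> E" "Z \<in> E"
  shows "koszul M g X Y (\<phi> \<odot>\<^bsub>vector_fields M\<^esub> Z) = \<phi> \<otimes>\<^bsub>C_inf M\<^esub> koszul M g X Y Z"
  by (rule C_inf_eqI)
    (use assms in \<open>auto simp: koszul_apply lie_bracket_smult_left lie_bracket_smult_right
      g_sym[of Z X] g_sym[of Z Y] g_sym[of Y X] field_simps\<close>)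

text \<open>The terms with Z(\<phi>) cancel, whereas X(\<phi>) g(Y,Z) occurs twice, from the first
  derivative and from [X, \<phi> Y]; the factor 1/2 leaves it once.\<close>

lemma koszul_Leibniz:
  assumes "\<phi> \<in> C" "X \<in> E" "Y \<in> E" "Z \<in> E"
  shows "koszul M g X (\<phi> \<odot>\<^bsub>vector_fields M\<^esub> Y) Z =
    (apply_field M X \<phi> \<otimes>\<^bsub>C_inf M\<^esub> g Y Z) \<oplus>\<^bsub>C_inf M\<^esub> (\<phi> \<otimes>\<^bsub>C_inf M\<^esub> koszul M g X Y Z)"
  by (rule C_inf_eqI)
    (use assms in \<open>auto simp: koszul_apply lie_bracket_smult_left lie_bracket_smult_right
      g_sym[of Z X] g_sym[of Z Y] g_sym[of Y X] field_simps\<close>)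

text \<open>Exchanging X and Y reverses the sign of g([X,Y],Z) and preserves the sum of the other
  five terms.\<close>

lemma koszul_torsion_free:
  assumes "X \<in> E" "Y \<in> E" "Z \<in> E" "p \<in> points M"
  shows "koszul M g X Y Z p - koszul M g Y X Z p = g (lie_bracket M X Y) Z p"
  using assms
  by (simp add: koszul_apply lie_bracket_swap[of X Y] lie_bracket_swap[of Y Z]
      lie_bracket_swap[of X Z] g_sym[of Z X] g_sym[of Z Y] g_sym[of Y X] field_simps)

text \<open>Exchanging Y and Z preserves X(g(Y,Z)) and reverses the sign of the sum of the other
  five terms.\<close>

lemma koszul_compatible:
  assumes "X \<in> E" "Y \<in> E" "Z \<in> E"
  shows "apply_field M X (g Y Z) = koszul M g X Y Z \<oplus>\<^bsub>C_inf M\<^esub> koszul M g X Z Y"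
  by (rule C_inf_eqI)
    (use assms in \<open>auto simp: koszul_apply lie_bracket_swap[of X Y] lie_bracket_swap[of Y Z]
      lie_bracket_swap[of X Z] g_sym[of Z X] g_sym[of Z Y] g_sym[of Y X] field_simps\<close>)

text \<open>At a fixed point this is linear algebra: the six values of \<open>n\<close> on the
  permutations of X, Y, Z satisfy three compatibility and three torsion equations. Combined with the
  Koszul signs, these leave only 2 n(X,Y,Z).\<close>

lemma koszul_unique:
  assumes comp: "\<And>X Y Z. X \<in> E \<Longrightarrow> Y \<in> E \<Longrightarrow> Z \<in> E \<Longrightarrow> X p (g Y Z) = n X Y Z + n X Z Y"
    and tors: "\<And>X Y Z. X \<in> E \<Longrightarrow> Y \<in> E \<Longrightarrow> Z \<in> E \<Longrightarrow>
      n X Y Z - n Y X Z = g (lie_bracket M X Y) Z p"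
    and "X \<in> E" "Y \<in> E" "Z \<in> E" "p \<in> points M"
  shows "n X Y Z = koszul M g X Y Z p"
  using assms(3-) comp[of X Y Z] comp[of Y Z X] comp[of Z X Y]
    tors[of X Y Z] tors[of Y Z X] tors[of Z X Y]
  by (simp add: koszul_apply)

end

section \<open>The pseudoconnection\<close>

text \<open>The head of the tuple is the third Koszul argument, while the tail is a parameter of the
  form. The restricted abstractions make the result extensional in each argument.\<close>

definition koszul_connection ::
  "'a manifold \<Rightarrow> nat \<Rightarrow> ('a vfield \<Rightarrow> 'a vfield list \<Rightarrow> 'a \<Rightarrow> real) \<Rightarrow>
   'a vfield \<Rightarrow> 'a vfield \<Rightarrow> 'a vfield list \<Rightarrow> 'a \<Rightarrow> real" where
  "koszul_connection M k P = (\<lambda>X\<in>carrier (vector_fields M). \<lambda>Y\<in>carrier (vector_fields M).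
     \<lambda>Zs\<in>field_tuples M k. koszul M (\<lambda>Y Z. P Y (Z # tl Zs)) X Y (hd Zs))"

section \<open>The module of maps linear in the first variable\<close>

lemma Cons_field_tuples [simp]:
  "Z # Zs \<in> field_tuples M (Suc m) \<longleftrightarrow> Z \<in> carrier (vector_fields M) \<and> Zs \<in> field_tuples M m"
  by (auto simp: field_tuples_def)

lemma field_tuples_SucE:
  assumes "Xs \<in> field_tuples M (Suc m)"
  obtains Z Zs where "Xs = Z # Zs" "Z \<in> carrier (vector_fields M)" "Zs \<in> field_tuples M m"
  using assms by (cases Xs) (auto simp: field_tuples_def)

lemma Dk0_simps [simp]:
  "Xs \<in> field_tuples M k \<Longrightarrow> (d \<oplus>\<^bsub>Dk0 M k\<^esub> e) Xs = d Xs \<oplus>\<^bsub>C_inf M\<^esub> e Xs"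
  "Xs \<in> field_tuples M k \<Longrightarrow> (\<phi> \<odot>\<^bsub>Dk0 M k\<^esub> d) Xs = \<phi> \<otimes>\<^bsub>C_inf M\<^esub> d Xs"
  "Xs \<in> field_tuples M k \<Longrightarrow> \<zero>\<^bsub>Dk0 M k\<^esub> Xs = \<zero>\<^bsub>C_inf M\<^esub>"
  by (simp_all add: Dk0_def Dk_def)

lemma Dk0_extensional [simp]:
  "d \<oplus>\<^bsub>Dk0 M k\<^esub> e \<in> extensional (field_tuples M k)"
  "\<phi> \<odot>\<^bsub>Dk0 M k\<^esub> d \<in> extensional (field_tuples M k)"
  "\<zero>\<^bsub>Dk0 M k\<^esub> \<in> extensional (field_tuples M k)"
  by (auto simp: Dk0_def Dk_def PiE_def)

lemma Dk0_app_C: "d \<in> carrier (Dk0 M k) \<Longrightarrow> Xs \<in> field_tuples M k \<Longrightarrow> d Xs \<in> carrier (C_inf M)"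
  by (auto simp: Dk0_def Dk_def)

context manifold_setting
begin

text \<open>With k = \<open>Suc m\<close>, every k-tuple is a cons: its head is the linear slot and
  its tail consists of the m = k - 1 remaining fields.\<close>

lemma Dk0_I:
  assumes "d \<in> extensional (field_tuples M (Suc m))"
    and "\<And>Z Zs. Z \<in> E \<Longrightarrow> Zs \<in> field_tuples M m \<Longrightarrow> d (Z # Zs) \<in> C"
    and "\<And>X Y Zs. X \<in> E \<Longrightarrow> Y \<in> E \<Longrightarrow> Zs \<in> field_tuples M m \<Longrightarrow>
      d ((X \<oplus>\<^bsub>vector_fields M\<^esub> Y) # Zs) = d (X # Zs) \<oplus>\<^bsub>C_inf M\<^esub> d (Y # Zs)"
    and "\<And>\<phi> X Zs. \<phi> \<in> C \<Longrightarrow> X \<in> E \<Longrightarrow> Zs \<in> field_tuples M m \<Longrightarrow>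
      d ((\<phi> \<odot>\<^bsub>vector_fields M\<^esub> X) # Zs) = \<phi> \<otimes>\<^bsub>C_inf M\<^esub> d (X # Zs)"
  shows "d \<in> carrier (Dk0 M (Suc m))"
  using assms by (auto simp: Dk0_def Dk_def PiE_def elim!: field_tuples_SucE)

lemma Dk0_linear:
  assumes "d \<in> carrier (Dk0 M (Suc m))" "X \<in> E" "Zs \<in> field_tuples M m"
  shows "Y \<in> E \<Longrightarrow> d ((X \<oplus>\<^bsub>vector_fields M\<^esub> Y) # Zs) = d (X # Zs) \<oplus>\<^bsub>C_inf M\<^esub> d (Y # Zs)"
    and "\<phi> \<in> C \<Longrightarrow> d ((\<phi> \<odot>\<^bsub>vector_fields M\<^esub> X) # Zs) = \<phi> \<otimes>\<^bsub>C_inf M\<^esub> d (X # Zs)"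
  using assms by (auto simp: Dk0_def Dk_def)

lemma Dk0_carrier_extensional [simp]:
  "d \<in> carrier (Dk0 M k) \<Longrightarrow> d \<in> extensional (field_tuples M k)"
  by (auto simp: Dk0_def Dk_def PiE_def)

lemma Dk0_eqI:
  assumes "d \<in> carrier (Dk0 M (Suc m))" "e \<in> carrier (Dk0 M (Suc m))"
    and "\<And>Z Zs p. Z \<in> E \<Longrightarrow> Zs \<in> field_tuples M m \<Longrightarrow> p \<in> points M \<Longrightarrow> d (Z # Zs) p = e (Z # Zs) p"
  shows "d = e"
proof (rule extensionalityI[of _ "field_tuples M (Suc m)"])
  fix Xs assume Xs: "Xs \<in> field_tuples M (Suc m)"
  show "d Xs = e Xs"
    by (rule C_inf_eqI)
      (use assms Xs in \<open>auto simp: Dk0_app_C elim!: field_tuples_SucE\<close>)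
qed (use assms(1,2) in simp_all)

lemma Dk0_zero_closed [simp]: "\<zero>\<^bsub>Dk0 M (Suc m)\<^esub> \<in> carrier (Dk0 M (Suc m))"
  by (rule Dk0_I; simp) (rule C_inf_eqI; simp)+

lemma Dk0_add_closed [simp]:
  assumes "d \<in> carrier (Dk0 M (Suc m))" "e \<in> carrier (Dk0 M (Suc m))"
  shows "d \<oplus>\<^bsub>Dk0 M (Suc m)\<^esub> e \<in> carrier (Dk0 M (Suc m))"
  by (rule Dk0_I; use assms in \<open>simp add: Dk0_app_C\<close>)
    (rule C_inf_eqI; use assms in \<open>simp add: Dk0_linear algebra_simps\<close>)+

lemma Dk0_smult_closed [simp]:
  assumes "\<phi> \<in> C" "d \<in> carrier (Dk0 M (Suc m))"
  shows "\<phi> \<odot>\<^bsub>Dk0 M (Suc m)\<^esub> d \<in> carrier (Dk0 M (Suc m))"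
  by (rule Dk0_I; use assms in \<open>simp add: Dk0_app_C\<close>)
    (rule C_inf_eqI; use assms in \<open>simp add: Dk0_linear algebra_simps\<close>)+

text \<open>Subtraction in \<open>torsion_free\<close> unfolds to an additive inverse, which is a
  definite description. It is evaluated by checking directly that the candidate is an inverse and
  that every inverse equals it.\<close>

lemma Dk0_a_inv:
  assumes d: "d \<in> carrier (Dk0 M (Suc m))"
  shows "\<ominus>\<^bsub>Dk0 M (Suc m)\<^esub> d = const_fun M (-1) \<odot>\<^bsub>Dk0 M (Suc m)\<^esub> d" (is "_ = ?e")
proof -
  \<comment> \<open>Both halves of that check become equations between real numbers.\<close>
  have zero: "d' \<oplus>\<^bsub>Dk0 M (Suc m)\<^esub> e' = \<zero>\<^bsub>Dk0 M (Suc m)\<^esub> \<longleftrightarrow>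
      (\<forall>Z\<in>E. \<forall>Zs\<in>field_tuples M m. \<forall>p\<in>points M. d' (Z # Zs) p + e' (Z # Zs) p = 0)"
    if "d' \<in> carrier (Dk0 M (Suc m))" "e' \<in> carrier (Dk0 M (Suc m))" for d' e'
  proof
    assume eq: "d' \<oplus>\<^bsub>Dk0 M (Suc m)\<^esub> e' = \<zero>\<^bsub>Dk0 M (Suc m)\<^esub>"
    have "(d' \<oplus>\<^bsub>Dk0 M (Suc m)\<^esub> e') (Z # Zs) p = 0"
      if "Z \<in> E" "Zs \<in> field_tuples M m" "p \<in> points M" for Z Zs p
      unfolding eq using that by simp
    then show "\<forall>Z\<in>E. \<forall>Zs\<in>field_tuples M m. \<forall>p\<in>points M. d' (Z # Zs) p + e' (Z # Zs) p = 0"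
      by simp
  next
    assume "\<forall>Z\<in>E. \<forall>Zs\<in>field_tuples M m. \<forall>p\<in>points M. d' (Z # Zs) p + e' (Z # Zs) p = 0"
    then show "d' \<oplus>\<^bsub>Dk0 M (Suc m)\<^esub> e' = \<zero>\<^bsub>Dk0 M (Suc m)\<^esub>"
      by (intro Dk0_eqI[where m = m]) (use that in auto)
  qed
  have e: "?e \<in> carrier (Dk0 M (Suc m))"
    using d by simp
  show ?thesis
    unfolding a_inv_def m_inv_def
  proof (rule the_equality)
    show "?e \<in> carrier (add_monoid (Dk0 M (Suc m))) \<and>
      d \<otimes>\<^bsub>add_monoid (Dk0 M (Suc m))\<^esub> ?e = \<one>\<^bsub>add_monoid (Dk0 M (Suc m))\<^esub> \<and>
      ?e \<otimes>\<^bsub>add_monoid (Dk0 M (Suc m))\<^esub> d = \<one>\<^bsub>add_monoid (Dk0 M (Suc m))\<^esub>"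
      using d e by (simp add: zero)
  next
    fix y
    assume "y \<in> carrier (add_monoid (Dk0 M (Suc m))) \<and>
      d \<otimes>\<^bsub>add_monoid (Dk0 M (Suc m))\<^esub> y = \<one>\<^bsub>add_monoid (Dk0 M (Suc m))\<^esub> \<and>
      y \<otimes>\<^bsub>add_monoid (Dk0 M (Suc m))\<^esub> d = \<one>\<^bsub>add_monoid (Dk0 M (Suc m))\<^esub>"
    then have y: "y \<in> carrier (Dk0 M (Suc m))" and "y \<oplus>\<^bsub>Dk0 M (Suc m)\<^esub> d = \<zero>\<^bsub>Dk0 M (Suc m)\<^esub>"
      by simp_all
    then have "\<forall>Z\<in>E. \<forall>Zs\<in>field_tuples M m. \<forall>p\<in>points M. y (Z # Zs) p + d (Z # Zs) p = 0"
      using zero d by blast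
    then show "y = ?e"
      by (intro Dk0_eqI[where m = m]) (use d y in \<open>auto simp: add_eq_0_iff2\<close>)
  qed
qed

lemma Dk0_a_minus:
  assumes "d \<in> carrier (Dk0 M (Suc m))" "e \<in> carrier (Dk0 M (Suc m))"
    "Z \<in> E" "Zs \<in> field_tuples M m" "p \<in> points M"
  shows "(d \<ominus>\<^bsub>Dk0 M (Suc m)\<^esub> e) (Z # Zs) p = d (Z # Zs) p - e (Z # Zs) p"
  using assms by (simp add: a_minus_def Dk0_a_inv)

lemma Dk0_a_minus_closed [simp]:
  assumes "d \<in> carrier (Dk0 M (Suc m))" "e \<in> carrier (Dk0 M (Suc m))"
  shows "d \<ominus>\<^bsub>Dk0 M (Suc m)\<^esub> e \<in> carrier (Dk0 M (Suc m))"
  using assms by (simp add: a_minus_def Dk0_a_inv)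

end

section \<open>Existence: the Koszul pseudoconnection of a symmetric homomorphism\<close>

locale symmetric_hom_setting = manifold_setting M for M :: "'a manifold" +
  fixes m :: nat and P :: "'a vfield \<Rightarrow> 'a vfield list \<Rightarrow> 'a \<Rightarrow> real"
  assumes hom: "P \<in> module_homs (C_inf M) (vector_fields M) (Dk0 M (Suc m))"
    and sym: "symmetric_hom M (Suc m) P"
begin

abbreviation nabla where "nabla \<equiv> koszul_connection M (Suc m) P"

lemma P_Dk0 [simp]: "X \<in> E \<Longrightarrow> P X \<in> carrier (Dk0 M (Suc m))"
  using hom by (auto simp: module_homs_def)

text \<open>Linearity in the first slot is the homomorphism property of \<open>P\<close>, and
  exchange of the two slots is its symmetry.\<close>

lemma symmetric_bilinear_form_P:
  assumes Zs: "Zs \<in> field_tuples M m"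
  shows "symmetric_bilinear_form M (\<lambda>Y Z. P Y (Z # Zs))"
proof unfold_locales
  show "P X (Y # Zs) \<in> C" if "X \<in> E" "Y \<in> E" for X Y
    using that Zs by (simp add: Dk0_app_C[of _ M "Suc m"])
  show "P X (Y # Zs) = P Y (X # Zs)" if "X \<in> E" "Y \<in> E" for X Y
    using that Zs sym by (simp add: symmetric_hom_def)
  show "P (X \<oplus>\<^bsub>vector_fields M\<^esub> X') (Y # Zs) = P X (Y # Zs) \<oplus>\<^bsub>C_inf M\<^esub> P X' (Y # Zs)"
    if "X \<in> E" "X' \<in> E" "Y \<in> E" for X X' Y
    using that Zs hom by (simp add: module_homs_def)
  show "P (\<phi> \<odot>\<^bsub>vector_fields M\<^esub> X) (Y # Zs) = \<phi> \<otimes>\<^bsub>C_inf M\<^esub> P X (Y # Zs)"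
    if "\<phi> \<in> C" "X \<in> E" "Y \<in> E" for \<phi> X Y
    using that Zs hom by (simp add: module_homs_def)
qed

lemma nabla_apply [simp]:
  "X \<in> E \<Longrightarrow> Y \<in> E \<Longrightarrow> Z \<in> E \<Longrightarrow> Zs \<in> field_tuples M m \<Longrightarrow>
    nabla X Y (Z # Zs) = koszul M (\<lambda>Y Z. P Y (Z # Zs)) X Y Z"
  by (simp add: koszul_connection_def)

text \<open>The linearity demanded of members of \<open>Dk0\<close> is that of the Koszul expression
  in its third argument.\<close>

lemma nabla_Dk0 [simp]:
  assumes "X \<in> E" "Y \<in> E"
  shows "nabla X Y \<in> carrier (Dk0 M (Suc m))"
  by (rule Dk0_I)
    (use assms in \<open>auto simp: koszul_connection_def symmetric_bilinear_form.koszul_C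
      symmetric_bilinear_form.koszul_add symmetric_bilinear_form.koszul_smult_right symmetric_bilinear_form_P\<close>)

lemma nabla_add:
  assumes "X \<in> E" "Y \<in> E" "Z \<in> E"
  shows "nabla (X \<oplus>\<^bsub>vector_fields M\<^esub> Y) Z = nabla X Z \<oplus>\<^bsub>Dk0 M (Suc m)\<^esub> nabla Y Z"
    and "nabla Z (X \<oplus>\<^bsub>vector_fields M\<^esub> Y) = nabla Z X \<oplus>\<^bsub>Dk0 M (Suc m)\<^esub> nabla Z Y"
  by - (rule Dk0_eqI[where m = m];
      use assms in \<open>simp add: symmetric_bilinear_form.koszul_add symmetric_bilinear_form_P\<close>)+

lemma nabla_smult_left:
  assumes "\<phi> \<in> C" "X \<in> E" "Y \<in> E"
  shows "nabla (\<phi> \<odot>\<^bsub>vector_fields M\<^esub> X) Y = \<phi> \<odot>\<^bsub>Dk0 M (Suc m)\<^esub> nabla X Y"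
  by (rule Dk0_eqI[where m = m];
      use assms in \<open>simp add: symmetric_bilinear_form.koszul_smult_left symmetric_bilinear_form_P\<close>)

lemma nabla_Leibniz:
  assumes "\<phi> \<in> C" "X \<in> E" "Y \<in> E"
  shows "nabla X (\<phi> \<odot>\<^bsub>vector_fields M\<^esub> Y) = (apply_field M X \<phi> \<odot>\<^bsub>Dk0 M (Suc m)\<^esub> P Y)
    \<oplus>\<^bsub>Dk0 M (Suc m)\<^esub> (\<phi> \<odot>\<^bsub>Dk0 M (Suc m)\<^esub> nabla X Y)"
  by (rule Dk0_eqI[where m = m];
      use assms in \<open>simp add: symmetric_bilinear_form.koszul_Leibniz symmetric_bilinear_form_P\<close>)

lemma nabla_smult_const_right:
  assumes "X \<in> E" "Y \<in> E"
  shows "nabla X (const_fun M c \<odot>\<^bsub>vector_fields M\<^esub> Y) = const_fun M c \<odot>\<^bsub>Dk0 M (Suc m)\<^esub> nabla X Y"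
  \<comment> \<open>Real homogeneity is the Leibniz rule for a constant function, whose derivative
    along X vanishes.\<close>
  unfolding nabla_Leibniz[OF const_fun_C assms]
  by (rule Dk0_eqI[where m = m])
    (use assms in auto)

lemma principal_hom_nabla: "principal_hom M (Dk0 M (Suc m)) nabla P"
  using hom by (simp add: principal_hom_def nabla_smult_left nabla_Leibniz)

lemma pseudoconnection_nabla: "pseudoconnection M (Dk0 M (Suc m)) nabla"
proof -
  have "nabla \<in> E \<rightarrow>\<^sub>E (E \<rightarrow>\<^sub>E carrier (Dk0 M (Suc m)))"
    using nabla_Dk0 by (auto simp: PiE_def extensional_def koszul_connection_def)
  moreover have "real_bilinear M (Dk0 M (Suc m)) nabla"
    by (simp add: real_bilinear_def nabla_add nabla_smult_left nabla_smult_const_right)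
  ultimately show ?thesis
    using principal_hom_nabla by (auto simp: pseudoconnection_def)
qed

lemma torsion_free_nabla: "torsion_free M (Dk0 M (Suc m)) P nabla"
  unfolding torsion_free_def
proof (intro ballI)
  fix X Y assume "X \<in> E" "Y \<in> E"
  then show "nabla X Y \<ominus>\<^bsub>Dk0 M (Suc m)\<^esub> nabla Y X = P (lie_bracket M X Y)"
    by (intro Dk0_eqI[where m = m]) (auto simp: Dk0_a_minus
        symmetric_bilinear_form.koszul_torsion_free symmetric_bilinear_form_P)
qed

lemma compatible_nabla: "compatible M (Suc m) P nabla"
  unfolding compatible_def diff_Suc_1
proof (intro ballI)
  fix X Y Z Zs assume XYZ: "X \<in> E" "Y \<in> E" "Z \<in> E" and Zs: "Zs \<in> field_tuples M m"
  interpret symmetric_bilinear_form M "\<lambda>Y Z. P Y (Z # Zs)"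
    using Zs by (rule symmetric_bilinear_form_P)
  show "apply_field M X (P Y (Z # Zs)) = nabla X Y (Z # Zs) \<oplus>\<^bsub>C_inf M\<^esub> nabla X Z (Y # Zs)"
    using koszul_compatible XYZ Zs by simp
qed

section \<open>Uniqueness of the pseudoconnection\<close>

lemma nabla_unique:
  assumes n: "n \<in> E \<rightarrow>\<^sub>E (E \<rightarrow>\<^sub>E carrier (Dk0 M (Suc m)))"
    and tors: "torsion_free M (Dk0 M (Suc m)) P n"
    and comp: "compatible M (Suc m) P n"
  shows "n = nabla"
proof -
  have n_Dk0: "n X Y \<in> carrier (Dk0 M (Suc m))" if "X \<in> E" "Y \<in> E" for X Y
    using n that by (auto simp: PiE_def)
  have "n X Y (Z # Zs) p = nabla X Y (Z # Zs) p"
    if "X \<in> E" "Y \<in> E" "Z \<in> E" and Zs: "Zs \<in> field_tuples M m" and p: "p \<in> points M" for X Y Z Zs p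
  proof -
    interpret symmetric_bilinear_form M "\<lambda>Y Z. P Y (Z # Zs)"
      using Zs by (rule symmetric_bilinear_form_P)
    have "n X Y (Z # Zs) p = koszul M (\<lambda>Y Z. P Y (Z # Zs)) X Y Z p"
    \<comment> \<open>With \<open>Zs\<close> and \<open>p\<close> frozen, the two axioms become the
      numerical equations of \<open>koszul_unique\<close>.\<close>
    proof (rule koszul_unique[where n = "\<lambda>X Y Z. n X Y (Z # Zs) p"])
      fix X Y Z assume XYZ: "X \<in> E" "Y \<in> E" "Z \<in> E"
      have "apply_field M X (P Y (Z # Zs)) p = (n X Y (Z # Zs) \<oplus>\<^bsub>C_inf M\<^esub> n X Z (Y # Zs)) p"
        using comp XYZ Zs by (simp add: compatible_def)
      then show "X p (P Y (Z # Zs)) = n X Y (Z # Zs) p + n X Z (Y # Zs) p"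
        using p by simp
      have "(n X Y \<ominus>\<^bsub>Dk0 M (Suc m)\<^esub> n Y X) (Z # Zs) p = P (lie_bracket M X Y) (Z # Zs) p"
        using tors XYZ by (simp add: torsion_free_def)
      then show "n X Y (Z # Zs) p - n Y X (Z # Zs) p = P (lie_bracket M X Y) (Z # Zs) p"
        using XYZ Zs p n_Dk0 by (simp add: Dk0_a_minus)
    qed (use that in auto)
    then show ?thesis
      using that by simp
  qed
  then have "n X Y = nabla X Y" if "X \<in> E" "Y \<in> E" for X Y
    \<comment> \<open>Values of \<open>nabla\<close> stay folded so that the goal matches the
      pointwise equation just proved.\<close>
    using that n_Dk0 nabla_Dk0 by (intro Dk0_eqI[where m = m]) (auto simp del: nabla_apply)
  moreover have "nabla \<in> E \<rightarrow>\<^sub>E (E \<rightarrow>\<^sub>E carrier (Dk0 M (Suc m)))"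
    using pseudoconnection_nabla by (simp add: pseudoconnection_def)
  ultimately show ?thesis
    \<comment> \<open>Both maps are extensional in each of their two field arguments, so agreement
      on \<open>E\<close> gives equality as functions.\<close>
    using n by (intro PiE_ext[of n E _ nabla] PiE_ext[of "n _" E _ "nabla _"]) (auto simp: PiE_mem)
qed

end

theorem proposition3p8:
  fixes M :: "'a manifold" and k :: nat
    and P :: "'a vfield \<Rightarrow> 'a vfield list \<Rightarrow> 'a \<Rightarrow> real"
  assumes "smooth_manifold M"
    and "k \<ge> 1"
    and "P \<in> module_homs (C_inf M) (vector_fields M) (Dk0 M k)"
    and "symmetric_hom M k P"
  shows "\<exists>!nabla. pseudoconnection M (Dk0 M k) nabla \<and> principal_hom M (Dk0 M k) nabla P \<and>
           torsion_free M (Dk0 M k) P nabla \<and> compatible M k P nabla"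
proof -
  obtain m where k: "k = Suc m"
    using assms(2) by (cases k) auto
  interpret symmetric_hom_setting M m P
    using assms by unfold_locales (auto simp: k)
  show ?thesis
    unfolding k
    by (rule ex1I[of _ nabla])
      (use pseudoconnection_nabla principal_hom_nabla torsion_free_nabla compatible_nabla
        nabla_unique in \<open>auto simp: pseudoconnection_def\<close>)
qed

end
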